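(* Let $p$ be a prime integer, let $G$ be the group $\mathbb{Z}/p\mathbb{Z}\times\mathbb{Z}/p\mathbb{Z}$, and let $s_1,\dots,s_{p+1}$ be $p+1$ distinct nonzero elements of $G$. Then for any nonzero $g$ in $G$, there exist non-negative integers $d_1,\dots,d_{p+1}$ with $\sum_{i=1}^{p+1} d_i\leq p-1$ such that $d_1s_1+\dots+d_{p+1}s_{p+1}=g$.
   Context: $G$ is regarded as an additive group. *)

theory Defs
  imports "HOL-Algebra.Algebra" "HOL-Computational_Algebra.Primes"
begin

hide_const (open) Divisibility.prime

text \<open>
  The additive group \<open>\<int>/p\<int> \<times> \<int>/p\<int>\<close>, on the representatives \<open>{0..<p}\<close>.  HOL-Algebra
  writes groups multiplicatively: \<open>\<one>\<close> is the zero \<open>(0, 0)\<close>, \<open>\<otimes>\<close> is componentwise addition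
  modulo \<open>p\<close>, \<open>x [^] d\<close> is the multiple \<open>d x\<close>, and \<open>finprod\<close> is the finite sum.
\<close>

definition ZZ_mod :: "nat \<Rightarrow> (int \<times> int) monoid" where
  "ZZ_mod p = integer_mod_group p \<times>\<times> integer_mod_group p"

lemma comm_group_ZZ_mod: "comm_group (ZZ_mod p)"
proof (rule group.group_comm_groupI)
  show "group (ZZ_mod p)"
    unfolding ZZ_mod_def by (simp add: DirProd_group)
qed (auto simp: ZZ_mod_def DirProd_def add.commute)

end

theory Submission
  imports Defs
begin

text \<open>
  Let \<open>A\<close> consist of zero and the \<open>p + 1\<close> given elements, so that \<open>A\<close> has \<open>p + 2\<close> elements.  Since
  \<open>A\<close> contains zero, the sums of at most \<open>p - 1\<close> given elements, repetition allowed, form the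
  \<open>(p - 1)\<close>-fold sumset of \<open>A\<close>, and it is enough that this sumset is all of \<open>G\<close>
  (\<open>nfold_eq_carrier\<close>).

  The tool is a theorem of Mann (\<open>mann\<close>): in a finite abelian group, the minimum of \<open>|U + A| - |U|\<close>
  over the nonempty \<open>U\<close> with \<open>U + A \<noteq> G\<close> is attained by a subgroup.  It is proved by
  Hamidoune's method: among all minimizers for \<open>A\<close> and for \<open>-A\<close> take one of least
  cardinality, an atom.  By submodularity of \<open>U \<mapsto> |U + A|\<close>, two atoms that meet coincide; as
  translates of an atom are atoms, an atom containing zero is a subgroup.

  If the minimum is at least \<open>p + 1\<close>, each added summand enlarges the sumset by at least
  \<open>p + 1\<close> until it fills \<open>G\<close>, and \<open>1 + (p - 1) (p + 1) = p\<^sup>2\<close>.  Otherwise a subgroup \<open>H\<close> with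
  \<open>H + A \<noteq> G\<close> satisfies \<open>|H + A| \<le> |H| + p\<close>.  As \<open>|A| > p + 1\<close>, the subgroup \<open>H\<close> is neither
  trivial nor \<open>G\<close>, hence \<open>|H| = p\<close>, and \<open>A\<close> lies in two cosets \<open>H\<close> and \<open>c + H\<close>.  Each contains
  at least two elements of \<open>A\<close>, because neither can hold more than \<open>p\<close>.  A summand with two choices
  inside one coset enlarges a set that has not yet reached \<open>p\<close> elements, so \<open>p - 1\<close> summands,
  \<open>i\<close> of them from \<open>c + H\<close> and the others from \<open>H\<close>, fill the coset \<open>i c + H\<close>
  (\<open>nfold_coset_growth\<close>); the cosets with \<open>0 \<le> i < p\<close> cover \<open>G\<close>.

  Groups are written multiplicatively below, and \<open>U <#> A\<close> is the sumset.
\<close>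

section \<open>Sumsets, translates and complements\<close>

context comm_group
begin

text \<open>
  The excess \<open>|UA| - |U|\<close>, taken in the integers because it can be negative when \<open>A\<close> is empty.
\<close>

definition growth :: "'a set \<Rightarrow> 'a set \<Rightarrow> int" where
  "growth A U = int (card (U <#> A)) - int (card U)"

text \<open>
  The sets \<open>U\<close> over which the growth is minimized.  The empty set and the sets whose product with
  \<open>A\<close> is the whole group are left out: otherwise \<open>{}\<close> and, for nonempty \<open>A\<close>, the whole group
  would have growth zero.
\<close>

definition nonfilling :: "'a set \<Rightarrow> 'a set \<Rightarrow> bool" where
  "nonfilling A U \<longleftrightarrow> U \<subseteq> carrier G \<and> U \<noteq> {} \<and> U <#> A \<noteq> carrier G"

lemma set_mult_Un_left: "(U \<union> V) <#> A = (U <#> A) \<union> (V <#> A)"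
  unfolding set_mult_def by blast

lemma set_mult_Int_left: "(U \<inter> V) <#> A \<subseteq> (U <#> A) \<inter> (V <#> A)"
  unfolding set_mult_def by blast

lemma subset_set_mult_one:
  assumes "U \<subseteq> carrier G" "\<one> \<in> A"
  shows "U \<subseteq> U <#> A"
proof
  fix u assume "u \<in> U"
  moreover from this have "u = u \<otimes> \<one>" using assms(1) by auto
  ultimately show "u \<in> U <#> A" using assms(2) unfolding set_mult_def by blast
qed

lemma subset_one_set_mult:
  assumes "A \<subseteq> carrier G" "\<one> \<in> U"
  shows "A \<subseteq> U <#> A"
proof
  fix a assume "a \<in> A"
  moreover from this have "a = \<one> \<otimes> a" using assms(1) by auto
  ultimately show "a \<in> U <#> A" using assms(2) unfolding set_mult_def by blast
qed

lemma card_r_coset: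
  assumes "x \<in> carrier G" "U \<subseteq> carrier G"
  shows "card (U #> x) = card U"
proof -
  have "U #> x \<in> rcosets U" using assms(1) unfolding RCOSETS_def by blast
  then show ?thesis using card_rcosets_equal assms(2) by metis
qed

lemma card_translate:
  assumes "x \<in> carrier G" "U \<subseteq> carrier G"
  shows "card ((\<otimes>) x ` U) = card U"
  using assms by (intro card_image inj_on_subset[OF inj_on_cmult]) auto

lemma translate_set_mult:
  assumes "x \<in> carrier G" "U \<subseteq> carrier G" "A \<subseteq> carrier G"
  shows "((\<otimes>) x ` U) <#> A = (\<otimes>) x ` (U <#> A)"
proof -
  have "(x \<otimes> y) \<otimes> a = x \<otimes> (y \<otimes> a)" if "y \<in> U" "a \<in> A" for y a
    using assms that by (intro m_assoc) auto
  then show ?thesis unfolding set_mult_def by force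
qed

lemma growth_translate:
  assumes "x \<in> carrier G" "U \<subseteq> carrier G" "A \<subseteq> carrier G"
  shows "growth A ((\<otimes>) x ` U) = growth A U"
  using assms by (simp add: growth_def translate_set_mult card_translate set_mult_closed)

lemma nonfilling_translate:
  assumes "x \<in> carrier G" "nonfilling A U" "A \<subseteq> carrier G" "finite (carrier G)"
  shows "nonfilling A ((\<otimes>) x ` U)"
proof -
  have U: "U \<subseteq> carrier G" "U \<noteq> {}" "U <#> A \<noteq> carrier G"
    using assms by (auto simp: nonfilling_def)
  have "U <#> A \<subset> carrier G" using U(3) set_mult_closed[OF U(1) assms(3)] by blast
  then have "card (U <#> A) < card (carrier G)" using assms(4) by (rule psubset_card_mono[rotated])
  then have "card ((\<otimes>) x ` (U <#> A)) < card (carrier G)"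
    using card_translate[OF assms(1) set_mult_closed[OF U(1) assms(3)]] by simp
  then have "((\<otimes>) x ` U) <#> A \<noteq> carrier G"
    using translate_set_mult[OF assms(1) U(1) assms(3)] by auto
  then show ?thesis using U(1,2) assms(1) unfolding nonfilling_def by auto
qed

lemma set_mult_inv_complement:
  assumes "U \<subseteq> carrier G" "A \<subseteq> carrier G"
  shows "(carrier G - (U <#> A)) <#> (m_inv G ` A) \<subseteq> carrier G - U"
proof
  fix z assume "z \<in> (carrier G - (U <#> A)) <#> (m_inv G ` A)"
  then obtain y a where ya: "y \<in> carrier G" "y \<notin> U <#> A" "a \<in> A" "z = y \<otimes> inv a"
    unfolding set_mult_def by blast
  have a: "a \<in> carrier G" using ya assms by auto
  have "y = z \<otimes> a" using ya a by (simp add: m_assoc)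
  then have "z \<notin> U" using ya unfolding set_mult_def by blast
  then show "z \<in> carrier G - U" using ya a by simp
qed

text \<open>
  Complementation exchanges \<open>A\<close> and the set of inverses of \<open>A\<close>: the complement of \<open>UA\<close>
  has, with respect to the inverses of \<open>A\<close>, at most the growth that \<open>U\<close> has with respect to \<open>A\<close>.
  Hence the two minima agree.
\<close>

lemma complement_growth:
  assumes fin: "finite (carrier G)" and A: "A \<subseteq> carrier G" and U: "nonfilling A U"
  shows "nonfilling (m_inv G ` A) (carrier G - (U <#> A))"
    and "growth (m_inv G ` A) (carrier G - (U <#> A)) \<le> growth A U"
proof -
  have Uc: "U \<subseteq> carrier G" "U \<noteq> {}" "U <#> A \<noteq> carrier G" using U by (auto simp: nonfilling_def)
  have sub: "U <#> A \<subseteq> carrier G" by (rule set_mult_closed[OF Uc(1) A])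
  note inc = set_mult_inv_complement[OF Uc(1) A]
  show "nonfilling (m_inv G ` A) (carrier G - (U <#> A))"
    using inc Uc sub unfolding nonfilling_def by blast
  have "card ((carrier G - (U <#> A)) <#> (m_inv G ` A)) \<le> card (carrier G - U)"
    using inc fin by (intro card_mono) auto
  moreover have "card (carrier G - U) = card (carrier G) - card U" "card U \<le> card (carrier G)"
    using Uc fin by (auto intro: card_Diff_subset card_mono finite_subset)
  moreover have "card (carrier G - (U <#> A)) = card (carrier G) - card (U <#> A)"
    "card (U <#> A) \<le> card (carrier G)"
    using sub fin by (auto intro: card_Diff_subset card_mono finite_subset)
  ultimately show "growth (m_inv G ` A) (carrier G - (U <#> A)) \<le> growth A U"
    unfolding growth_def by linarith
qed

section \<open>Atoms and Mann's theorem\<close>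

text \<open>
  Here \<open>k\<close> is the minimal growth and \<open>U\<close> an atom, a minimizer of least cardinality.  The
  assumption \<open>small\<close> says that \<open>U\<close> is no larger than the complement of \<open>UA\<close>; its use is
  to keep \<open>(U \<union> V)A\<close> away from the whole group.
\<close>

lemma atom_subset:
  assumes fin: "finite (carrier G)" and A: "A \<subseteq> carrier G"
    and min: "\<And>W. nonfilling A W \<Longrightarrow> k \<le> growth A W"
    and atom: "\<And>W. nonfilling A W \<Longrightarrow> growth A W = k \<Longrightarrow> card U \<le> card W"
    and U: "nonfilling A U" "growth A U = k"
    and V: "nonfilling A V" "growth A V = k" "card V = card U"
    and small: "card U + card (U <#> A) \<le> card (carrier G)"
    and meet: "U \<inter> V \<noteq> {}"
  shows "U \<subseteq> V"
proof -
  have c: "U \<subseteq> carrier G" "V \<subseteq> carrier G" using U V by (auto simp: nonfilling_def)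
  have cA: "U <#> A \<subseteq> carrier G" "V <#> A \<subseteq> carrier G" 
    using set_mult_closed[OF _ A] c by auto
  have f: "finite U" "finite V" "finite (U <#> A)" "finite (V <#> A)"
    using c cA by (auto intro: finite_subset[OF _ fin])
  have nI: "nonfilling A (U \<inter> V)"
    using meet U cA set_mult_Int_left[of U V A] unfolding nonfilling_def by blast
  have 1: "card U + card V = card (U \<union> V) + card (U \<inter> V)"
    using f(1,2) by (rule card_Un_Int)
  have "card ((U \<inter> V) <#> A) \<le> card ((U <#> A) \<inter> (V <#> A))"
    using f set_mult_Int_left by (intro card_mono) auto
  moreover have "card (U <#> A) + card (V <#> A)
      = card ((U \<union> V) <#> A) + card ((U <#> A) \<inter> (V <#> A))"
    unfolding set_mult_Un_left using f(3,4) by (rule card_Un_Int)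
  \<comment> \<open>Submodularity: the growths of \<open>U \<inter> V\<close> and \<open>U \<union> V\<close> add up to at most those of \<open>U\<close> and \<open>V\<close>.\<close>
  ultimately have sub: "growth A (U \<inter> V) + growth A (U \<union> V) \<le> 2 * k"
    using 1 U(2) V(2) unfolding growth_def by linarith
  have kI: "k \<le> growth A (U \<inter> V)" using min nI by blast
  have pos: "0 < card (U \<inter> V)" using meet f by (simp add: card_gt_0_iff)
  have "int (card ((U \<union> V) <#> A)) < int (card (carrier G))"
    using sub kI 1 pos small U(2) V(3) unfolding growth_def by linarith
  then have "nonfilling A (U \<union> V)" using c meet unfolding nonfilling_def by auto
  then have "growth A (U \<inter> V) = k" using min[of "U \<union> V"] kI sub by linarith
  then have "card U \<le> card (U \<inter> V)" using atom nI by blast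
  then have "U \<inter> V = U" using f by (intro card_seteq) auto
  then show ?thesis by blast
qed

lemma atom_subgroup:
  assumes fin: "finite (carrier G)" and A: "A \<subseteq> carrier G"
    and min: "\<And>W. nonfilling A W \<Longrightarrow> k \<le> growth A W"
    and atom: "\<And>W. nonfilling A W \<Longrightarrow> growth A W = k \<Longrightarrow> card U \<le> card W"
    and U: "nonfilling A U" "growth A U = k"
    and small: "card U + card (U <#> A) \<le> card (carrier G)"
    and one: "\<one> \<in> U"
  shows "subgroup U G"
proof -
  have c: "U \<subseteq> carrier G" using U by (auto simp: nonfilling_def)
  \<comment> \<open>The translate \<open>xU\<close> is an atom that meets \<open>U\<close> in \<open>x\<close>, so it contains \<open>U\<close>.\<close>
  have key: "inv x \<otimes> y \<in> U" if x: "x \<in> U" and y: "y \<in> U" for x y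
  proof -
    have xc: "x \<in> carrier G" "y \<in> carrier G" using x y c by auto
    have "x \<in> U \<inter> (\<otimes>) x ` U" using x one xc by force
    then have meet: "U \<inter> (\<otimes>) x ` U \<noteq> {}" by blast
    have xU: "nonfilling A ((\<otimes>) x ` U)" "growth A ((\<otimes>) x ` U) = k" "card ((\<otimes>) x ` U) = card U"
      using nonfilling_translate[OF xc(1) U(1) A fin] growth_translate[OF xc(1) c A]
        card_translate[OF xc(1) c] U(2) by simp_all
    have "U \<subseteq> (\<otimes>) x ` U"
      using atom_subset[OF fin A min atom U xU small meet] .
    then obtain z where "z \<in> U" "y = x \<otimes> z" using y by blast
    then show ?thesis using xc c by (auto simp: m_assoc[symmetric])
  qed
  have inv: "inv x \<in> U" if "x \<in> U" for x using key[OF that one] that c by auto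
  show ?thesis
  proof (rule subgroupI)
    show "x \<otimes> y \<in> U" if "x \<in> U" "y \<in> U" for x y
      using key[OF inv[OF that(1)] that(2)] that c by auto
  qed (use c one inv in auto)
qed

lemma inv_image_inv_image:
  assumes "A \<subseteq> carrier G" shows "m_inv G ` (m_inv G ` A) = A"
  using assms by (force simp: image_image)

text \<open>
  If \<open>U\<close> is smallest among the minimizers for \<open>A\<close> and those for the inverses of \<open>A\<close> together, the
  size condition on \<open>U\<close> is automatic, because the complement of \<open>UA\<close> is one of the latter.
\<close>

lemma small_atom_subgroup:
  assumes fin: "finite (carrier G)" and A: "A \<subseteq> carrier G"
    and min: "\<And>W. nonfilling A W \<Longrightarrow> k \<le> growth A W"
    and min': "\<And>W. nonfilling (m_inv G ` A) W \<Longrightarrow> k \<le> growth (m_inv G ` A) W"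
    and atom: "\<And>W. nonfilling A W \<Longrightarrow> growth A W = k \<Longrightarrow> card U \<le> card W"
    and atom': "\<And>W. nonfilling (m_inv G ` A) W \<Longrightarrow> growth (m_inv G ` A) W = k \<Longrightarrow> card U \<le> card W"
    and U: "nonfilling A U" "growth A U = k"
  shows "\<exists>H. subgroup H G \<and> nonfilling A H \<and> growth A H = k"
proof -
  have c: "U \<subseteq> carrier G" using U by (auto simp: nonfilling_def)
  obtain x where x: "x \<in> U" using U by (auto simp: nonfilling_def)
  then have xc: "x \<in> carrier G" using c by auto
  define V where "V = (\<otimes>) (inv x) ` U"
  have Vc: "V \<subseteq> carrier G" using xc c by (auto simp: V_def)
  have xi: "inv x \<in> carrier G" using xc by simp
  have V: "nonfilling A V" "growth A V = k" "card V = card U"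
    using nonfilling_translate[OF xi U(1) A fin] growth_translate[OF xi c A]
      card_translate[OF xi c] U(2) by (simp_all add: V_def)
  have oneV: "\<one> \<in> V" unfolding V_def using xc by (intro image_eqI[OF _ x]) simp
  have sub: "V <#> A \<subseteq> carrier G" by (rule set_mult_closed[OF Vc A])
  have "growth (m_inv G ` A) (carrier G - (V <#> A)) = k"
    using complement_growth[OF fin A V(1)] min' V(2) by force
  then have "card U \<le> card (carrier G - (V <#> A))"
    using atom' complement_growth(1)[OF fin A V(1)] by blast
  moreover have "card (carrier G - (V <#> A)) = card (carrier G) - card (V <#> A)"
    "card (V <#> A) \<le> card (carrier G)"
    using sub fin by (auto intro: card_Diff_subset card_mono finite_subset)
  ultimately have "card V + card (V <#> A) \<le> card (carrier G)" using V(3) by linarith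
  then have "subgroup V G"
    using atom_subgroup[OF fin A min _ V(1,2)] atom V(3) oneV by simp
  then show ?thesis using V by blast
qed

lemma card_inv_image:
  assumes "B \<subseteq> carrier G" shows "card (m_inv G ` B) = card B"
  using assms by (intro card_image inj_on_subset[OF inv_inj]) auto

lemma subgroup_set_mult_inv:
  assumes "subgroup H G" "A \<subseteq> carrier G"
  shows "H <#> (m_inv G ` A) = m_inv G ` (H <#> A)"
proof -
  interpret H: subgroup H G by fact
  have e: "inv (h \<otimes> a) = inv h \<otimes> inv a" if "h \<in> H" "a \<in> A" for h a
    using that assms by (intro inv_mult) (auto intro: H.mem_carrier)
  have "m_inv G ` H \<subseteq> H" by auto
  then have "m_inv G ` (m_inv G ` H) \<subseteq> m_inv G ` H" by (rule image_mono)
  then have "H = m_inv G ` H"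
    using \<open>m_inv G ` H \<subseteq> H\<close> unfolding inv_image_inv_image[OF H.subset] by (intro equalityI)
  then have "H <#> (m_inv G ` A) = (m_inv G ` H) <#> (m_inv G ` A)"
    by (rule arg_cong[of _ _ "\<lambda>K. K <#> (m_inv G ` A)"])
  also have "\<dots> = m_inv G ` (H <#> A)" using e unfolding set_mult_def by force
  finally show ?thesis .
qed

theorem mann:
  assumes fin: "finite (carrier G)" and A: "A \<subseteq> carrier G" and U: "nonfilling A U"
  shows "\<exists>H. subgroup H G \<and> nonfilling A H \<and> growth A H \<le> growth A U"
proof -
  let ?B = "m_inv G ` A"
  have B: "?B \<subseteq> carrier G" using A by auto
  have BB: "m_inv G ` ?B = A" using A by (rule inv_image_inv_image)
  have finF: "finite {W. nonfilling A W}"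
    by (rule finite_subset[of _ "Pow (carrier G)"]) (use fin in \<open>auto simp: nonfilling_def\<close>)
  define k where "k = Min (growth A ` {W. nonfilling A W})"
  have min: "k \<le> growth A W" if "nonfilling A W" for W
    unfolding k_def using finF that by (intro Min_le) auto
  have "k \<in> growth A ` {W. nonfilling A W}"
    unfolding k_def using finF U by (intro Min_in) auto
  then obtain U1 where U1: "nonfilling A U1" "growth A U1 = k" by auto
  have min': "k \<le> growth ?B W" if "nonfilling ?B W" for W
    using complement_growth[OF fin B that] min unfolding BB by force
  define P where "P W \<longleftrightarrow> (nonfilling A W \<and> growth A W = k) \<or> (nonfilling ?B W \<and> growth ?B W = k)" for W
  \<comment> \<open>A smallest minimizer for \<open>A\<close> or for its inverses; by symmetry either case gives a subgroup.\<close>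
  obtain U0 where U0: "P U0" "\<And>W. P W \<Longrightarrow> card U0 \<le> card W"
    using ex_has_least_nat[of P U1 card] U1 unfolding P_def by blast
  from U0(1) consider "nonfilling A U0" "growth A U0 = k" | "nonfilling ?B U0" "growth ?B U0 = k"
    unfolding P_def by blast
  then have "\<exists>H. subgroup H G \<and> nonfilling A H \<and> growth A H = k"
  proof cases
    case 1
    then show ?thesis
      using U0(2) min min' by (intro small_atom_subgroup[OF fin A, of k U0]) (auto simp: P_def)
  next
    case 2
    then have "\<exists>H. subgroup H G \<and> nonfilling ?B H \<and> growth ?B H = k"
      using U0(2) min min' by (intro small_atom_subgroup[OF fin B, of k U0]) (auto simp: P_def BB)
    then obtain H where H: "subgroup H G" "nonfilling ?B H" "growth ?B H = k" by blast
    have Hc: "H \<subseteq> carrier G" using H(1) by (rule subgroup.subset)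
    have HA: "H <#> A \<subseteq> carrier G" by (rule set_mult_closed[OF Hc A])
    have eq: "H <#> ?B = m_inv G ` (H <#> A)" by (rule subgroup_set_mult_inv[OF H(1) A])
    have "m_inv G ` carrier G = carrier G" using inv_image_inv_image[of "carrier G"] by auto
    then have "nonfilling A H" using H(2) unfolding nonfilling_def eq by auto
    moreover have "growth A H = k"
      using H(3) card_inv_image[OF HA] by (simp add: growth_def eq)
    ultimately show ?thesis using H by blast
  qed
  then show ?thesis using min[OF U] by metis
qed

end

section \<open>Iterated sumsets in groups of order \<open>p\<^sup>2\<close> and exponent \<open>p\<close>\<close>

text \<open>
  The set of products of exactly \<open>k\<close> elements of \<open>A\<close>, repetition allowed.  When \<open>A\<close> contains
  \<open>\<one>\<close>, these are the products of at most \<open>k\<close> elements.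
\<close>

primrec nfold :: "('a, 'b) monoid_scheme \<Rightarrow> 'a set \<Rightarrow> nat \<Rightarrow> 'a set" where
  "nfold G A 0 = {\<one>\<^bsub>G\<^esub>}"
| "nfold G A (Suc k) = nfold G A k <#>\<^bsub>G\<^esub> A"

context comm_group
begin

lemma nfold_closed: "A \<subseteq> carrier G \<Longrightarrow> nfold G A k \<subseteq> carrier G"
  by (induction k) (simp_all add: set_mult_closed)

text \<open>
  The Cauchy-Davenport inequality for a two-element set: if \<open>Ua\<close> and \<open>Ub\<close> coincide, then \<open>U\<close> is
  stable under multiplication by \<open>a \<otimes> inv b\<close>, which has order \<open>p\<close>, so \<open>U\<close> has at least \<open>p\<close>
  elements.
\<close>

lemma card_set_mult_pair:
  assumes U: "finite U" "U \<subseteq> carrier G" "U \<noteq> {}"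
    and ab: "a \<in> carrier G" "b \<in> carrier G" "a \<noteq> b"
    and p: "prime p" "(a \<otimes> inv b) [^] p = \<one>"
  shows "min p (card U + 1) \<le> card (U <#> {a, b})"
proof (rule ccontr)
  assume neg: "\<not> ?thesis"
  have c: "card (U #> x) = card U" if "x \<in> carrier G" for x
    by (rule card_r_coset[OF that U(2)])
  have fin: "finite (U <#> {a, b})" using U unfolding set_mult_def by auto
  have inc: "U #> x \<subseteq> U <#> {a, b}" if "x \<in> {a, b}" for x
    using that unfolding set_mult_def r_coset_def by blast
  have le: "card U \<le> card (U <#> {a, b})"
    using card_mono[OF fin inc[of a]] c[of a] ab by auto
  have "U #> x = U <#> {a, b}" if "x \<in> {a, b}" for x
    using neg c[of x] that ab by (intro card_seteq[OF fin inc]) auto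
  then have eq: "U #> a = U #> b" by blast
  define h where "h = a \<otimes> inv b"
  have h: "h \<in> carrier G" using ab by (simp add: h_def)
  have h1: "h \<noteq> \<one>" using ab unfolding h_def by (metis inv_equality inv_inv inv_closed)
  have step: "u \<otimes> h \<in> U" if "u \<in> U" for u
  proof -
    have "u \<otimes> a \<in> U #> b" using that eq unfolding r_coset_def by blast
    then obtain v where v: "v \<in> U" "u \<otimes> a = v \<otimes> b" unfolding r_coset_def by blast
    have "u \<in> carrier G" "v \<in> carrier G" using that v U by auto
    then have "u \<otimes> h = v" using v(2) ab by (simp add: h_def m_assoc[symmetric] inv_solve_right')
    then show ?thesis using v by simp
  qed
  obtain u where u: "u \<in> U" using U by blast
  have uc: "u \<in> carrier G" using u U by auto
  have pow: "u \<otimes> h [^] k \<in> U" for k :: nat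
  proof (induction k)
    case (Suc k)
    then show ?case using step[OF Suc] uc h by (simp add: m_assoc)
  qed (use u uc in simp)
  have "ord h dvd p" using p(2) h by (simp add: h_def pow_eq_id)
  then have "ord h = p" using p(1) h h1 ord_eq_1[of h] by (auto simp: prime_nat_iff)
  then have "inj_on (\<lambda>k::nat. h [^] k) {0..p - 1}" using ord_inj[OF h] by simp
  then have "inj_on (\<lambda>k::nat. u \<otimes> h [^] k) {0..p - 1}"
    using uc h by (auto simp: inj_on_def)
  moreover have "(\<lambda>k::nat. u \<otimes> h [^] k) ` {0..p - 1} \<subseteq> U" using pow by blast
  ultimately have "card {0..p - 1} \<le> card U" using U(1) by (rule card_inj_on_le)
  then have "p \<le> card U" by simp
  then show False using neg le by linarith
qed

lemma coset_powers_cover: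
  assumes fin: "finite (carrier G)" and p: "prime p" and ord: "order G = p * p"
    and exp: "\<And>x. x \<in> carrier G \<Longrightarrow> x [^] p = \<one>"
    and H: "subgroup H G" "card H = p" and c: "c \<in> carrier G" "c \<notin> H"
    and g: "g \<in> carrier G"
  shows "\<exists>i<p. g \<in> H #> c [^] i"
proof -
  interpret H: subgroup H G by (rule H(1))
  \<comment> \<open>The subgroup generated by \<open>H\<close> and \<open>c\<close>; its order divides \<open>p\<^sup>2\<close> and exceeds \<open>p\<close>.\<close>
  define K where "K = {h \<otimes> c [^] i | h i. h \<in> H \<and> i \<in> (UNIV :: nat set)}"
  have p0: "p > 0" using p by (simp add: prime_gt_0_nat)
  have KI: "h \<otimes> c [^] i \<in> K" if "h \<in> H" for h and i :: nat using that unfolding K_def by blast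
  have HK: "H \<subseteq> K"
  proof
    fix h assume "h \<in> H" then show "h \<in> K" using KI[of h 0] by simp
  qed
  have cK: "c \<in> K" using KI[of \<one> 1] c by simp
  have "subgroup K G"
  proof (rule subgroupI)
    show "K \<subseteq> carrier G" using c by (auto simp: K_def)
    show "K \<noteq> {}" using cK by blast
  next
    fix x assume "x \<in> K"
    then obtain h and i :: nat where x: "x = h \<otimes> c [^] i" "h \<in> H" unfolding K_def by blast
    have "c [^] i \<otimes> c [^] (i * (p - 1)) = (c [^] p) [^] i"
      using c p0 by (simp add: nat_pow_mult nat_pow_pow algebra_simps flip: mult_Suc)
    then have "c [^] i \<otimes> c [^] (i * (p - 1)) = \<one>" using exp c by simp
    then have "inv (c [^] i) = c [^] (i * (p - 1))"
      using c by (intro inv_equality) (auto simp: m_comm)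
    then have "inv x = inv h \<otimes> c [^] (i * (p - 1))"
      using x c by (simp add: inv_mult)
    then show "inv x \<in> K" using KI x by simp
  next
    fix x y assume "x \<in> K" "y \<in> K"
    then obtain h h' and i j :: nat
      where x: "x = h \<otimes> c [^] i" "h \<in> H" "y = h' \<otimes> c [^] j" "h' \<in> H" unfolding K_def by blast
    then have "x \<otimes> y = (h \<otimes> h') \<otimes> c [^] (i + j)"
      using c by (simp add: m_ac flip: nat_pow_mult)
    then show "x \<otimes> y \<in> K" using KI x by simp
  qed
  note K = this
  then have "card K dvd p * p" using lagrange[OF K] ord by (metis dvd_triv_right)
  then have "card K dvd p ^ 2" by (simp add: power2_eq_square)
  then obtain e where e: "e \<le> 2" "card K = p ^ e" using p by (auto simp: divides_primepow_nat)
  have Kc: "K \<subseteq> carrier G" using K by (rule subgroup.subset)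
  have "card H < card K"
    using HK cK c Kc fin by (intro psubset_card_mono) (auto intro: finite_subset)
  then have "p ^ 1 < p ^ e" using H e by simp
  then have "e = 2" using e(1) prime_gt_1_nat[OF p] by (metis le_antisym less_eq_Suc_le one_add_one
      plus_1_eq_Suc power_less_imp_less_exp)
  then have "card K = card (carrier G)" using e ord by (simp add: order_def power2_eq_square)
  then have "K = carrier G" using Kc fin by (intro card_subset_eq) auto
  then obtain h and i :: nat where g: "g = h \<otimes> c [^] i" "h \<in> H" using g unfolding K_def by blast
  have "c [^] i = c [^] (p * (i div p) + i mod p)" by simp
  also have "\<dots> = (c [^] p) [^] (i div p) \<otimes> c [^] (i mod p)"
    using c by (simp only: nat_pow_mult[symmetric] nat_pow_pow)
  also have "\<dots> = c [^] (i mod p)" using exp c by simp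
  finally have "c [^] i = c [^] (i mod p)" .
  then have "g \<in> H #> c [^] (i mod p)" using g unfolding r_coset_def by auto
  then show ?thesis using p0 by (intro exI[of _ "i mod p"]) auto
qed

text \<open>
  Products of \<open>k\<close> factors, \<open>i\<close> of them from the coset of \<open>c\<close> and the others from \<open>H\<close>, lie in the
  coset of \<open>c [^] i\<close>; each factor can be chosen from two elements and so contributes at least one
  new product, up to the bound \<open>p\<close>.
\<close>

lemma nfold_coset_growth:
  assumes fin: "finite (carrier G)" and p: "prime p"
    and exp: "\<And>x. x \<in> carrier G \<Longrightarrow> x [^] p = \<one>"
    and H: "subgroup H G" and c: "c \<in> carrier G" and A: "A \<subseteq> carrier G"
    and ab: "a \<in> A \<inter> H" "b \<in> A \<inter> H" "a \<noteq> b"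
    and ab': "a' \<in> A \<inter> (H #> c)" "b' \<in> A \<inter> (H #> c)" "a' \<noteq> b'"
    and i: "i \<le> k"
  shows "min p (k + 1) \<le> card (nfold G A k \<inter> (H #> c [^] i))"
  using i
proof (induction k arbitrary: i)
  case 0
  have "\<one> \<in> H #> \<one>" using subgroup.one_closed[OF H] by (force simp: r_coset_def)
  then show ?case using 0 by simp
next
  case (Suc k)
  interpret H: subgroup H G by (rule H)
  \<comment> \<open>The last factor comes from \<open>H\<close> if \<open>i = 0\<close>, and from the coset of \<open>c\<close> otherwise.\<close>
  have HA: "\<exists>x y j. x \<in> A \<and> y \<in> A \<and> x \<noteq> y \<and> j \<le> k \<and>
              (\<forall>z \<in> {x, y}. \<forall>u \<in> H #> c [^] j. u \<otimes> z \<in> H #> c [^] i)"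
  proof (cases i)
    case 0
    have "u \<otimes> z \<in> H" if "u \<in> H" "z \<in> {a, b}" for u z
      using that ab by auto
    then show ?thesis using 0 ab H.subset
      by (intro exI[of _ a] exI[of _ b] exI[of _ 0]) (simp add: coset_mult_one)
  next
    case (Suc j)
    have "u \<otimes> z \<in> H #> c [^] i" if uj: "u \<in> H #> c [^] j" and z: "z \<in> {a', b'}" for u z
    proof -
      have "z \<in> H #> c" using z ab' by auto
      then obtain h' where h': "h' \<in> H" "z = h' \<otimes> c" unfolding r_coset_def by auto
      obtain h where h: "h \<in> H" "u = h \<otimes> c [^] j" using uj unfolding r_coset_def by auto
      have "h \<in> carrier G" "h' \<in> carrier G" using h(1) h'(1) by auto
      then have "u \<otimes> z = (h \<otimes> h') \<otimes> (c [^] j \<otimes> c)"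
        using c unfolding h(2) h'(2) by (simp add: m_ac)
      then have "u \<otimes> z = (h \<otimes> h') \<otimes> c [^] i" unfolding \<open>i = Suc j\<close> by simp
      moreover have "h \<otimes> h' \<in> H" using h(1) h'(1) by simp
      ultimately show ?thesis unfolding r_coset_def by blast
    qed
    then show ?thesis using ab' Suc Suc.prems
      by (intro exI[of _ a'] exI[of _ b'] exI[of _ j]) auto
  qed
  then obtain x y j where xy: "x \<in> A" "y \<in> A" "x \<noteq> y" "j \<le> k"
    and z: "\<And>z u. z \<in> {x, y} \<Longrightarrow> u \<in> H #> c [^] j \<Longrightarrow> u \<otimes> z \<in> H #> c [^] i"
    by blast
  have xyc: "x \<in> carrier G" "y \<in> carrier G" using xy(1,2) A by auto
  define U where "U = nfold G A k \<inter> (H #> c [^] j)"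
  have U: "U \<subseteq> carrier G" using nfold_closed[OF A] by (auto simp: U_def)
  have fU: "finite U" using U fin by (rule finite_subset)
  have IH: "min p (k + 1) \<le> card U" using Suc.IH[OF xy(4)] by (simp add: U_def)
  moreover have "0 < min p (k + 1)" using prime_gt_0_nat[OF p] by simp
  ultimately have "U \<noteq> {}" by auto
  then have "min p (card U + 1) \<le> card (U <#> {x, y})"
    using U fU xy(3) xyc by (intro card_set_mult_pair p exp) simp_all
  moreover have "U <#> {x, y} \<subseteq> nfold G A (Suc k) \<inter> (H #> c [^] i)"
    using xy(1,2) z unfolding U_def nfold.simps set_mult_def by auto
  then have "card (U <#> {x, y}) \<le> card (nfold G A (Suc k) \<inter> (H #> c [^] i))"
    using nfold_closed[OF A, of "Suc k"]
    by (intro card_mono finite_Int disjI1) (simp_all add: finite_subset[OF _ fin] del: nfold.simps)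
  ultimately show ?case using IH by linarith
qed

lemma two_distinct_elements:
  assumes "2 \<le> card B"
  shows "\<exists>x y. x \<in> B \<and> y \<in> B \<and> x \<noteq> y"
proof -
  have "finite B" using assms card.infinite by fastforce
  then show ?thesis using card_le_Suc0_iff_eq[of B] assms by auto
qed

lemma nfold_two_cosets:
  assumes fin: "finite (carrier G)" and p: "prime p" and ord: "order G = p * p"
    and exp: "\<And>x. x \<in> carrier G \<Longrightarrow> x [^] p = \<one>"
    and A: "A \<subseteq> carrier G" "card A = p + 2" "\<one> \<in> A"
    and H: "subgroup H G" "card H = p" and HA: "card (H <#> A) \<le> 2 * p"
  shows "nfold G A (p - 1) = carrier G"
proof -
  interpret H: subgroup H G by (rule H(1))
  have fH: "finite H" using H.subset fin by (rule finite_subset)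
  have "\<not> A \<subseteq> H" using card_mono[OF fH, of A] H A by auto
  then obtain c where c: "c \<in> A" "c \<notin> H" by blast
  have cc: "c \<in> carrier G" using c A by auto
  have cardc: "card (H #> x) = p" if "x \<in> carrier G" for x
    using card_r_coset[OF that H.subset] H(2) by simp
  have finc: "finite (H #> x)" if "x \<in> carrier G" for x
    using fin finite_subset[OF r_coset_subset_G[OF H.subset that]] by blast
  have disj: "H \<inter> (H #> c) = {}"
  proof (rule ccontr)
    assume "\<not> ?thesis"
    then obtain h where h: "h \<in> H" "h \<otimes> c \<in> H" unfolding r_coset_def by blast
    then have "inv h \<otimes> (h \<otimes> c) \<in> H" by simp
    then show False using h(1) c(2) cc by (simp add: m_assoc[symmetric])
  qed
  have sub: "H \<union> (H #> c) \<subseteq> H <#> A"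
    using subset_set_mult_one[OF H.subset A(3)] c(1) unfolding set_mult_def r_coset_def by blast
  have fHA: "finite (H <#> A)"
    using set_mult_closed[OF H.subset A(1)] fin by (rule finite_subset)
  have "card (H \<union> (H #> c)) = 2 * p"
    using card_Un_disjoint[OF fH finc[OF cc] disj] cardc[OF cc] H(2) by simp
  \<comment> \<open>The bound on \<open>HA\<close> leaves room for only these two cosets.\<close>
  then have "H \<union> (H #> c) = H <#> A" using sub fHA HA by (intro card_seteq) auto
  moreover have "A \<subseteq> H <#> A"
    by (rule subset_one_set_mult[OF A(1) H.one_closed])
  ultimately have "A = (A \<inter> H) \<union> (A \<inter> (H #> c))" by blast
  then have "card A \<le> card (A \<inter> H) + card (A \<inter> (H #> c))" by (metis card_Un_le)
  moreover have "card (A \<inter> H) \<le> p" using card_mono[OF fH, of "A \<inter> H"] H by auto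
  moreover have "card (A \<inter> (H #> c)) \<le> p"
    using card_mono[OF finc[OF cc], of "A \<inter> (H #> c)"] cardc[OF cc] by auto
  ultimately have two: "2 \<le> card (A \<inter> H)" "2 \<le> card (A \<inter> (H #> c))" using A(2) by linarith+
  obtain a b where ab: "a \<in> A \<inter> H" "b \<in> A \<inter> H" "a \<noteq> b"
    using two_distinct_elements[OF two(1)] by blast
  obtain a' b' where ab': "a' \<in> A \<inter> (H #> c)" "b' \<in> A \<inter> (H #> c)" "a' \<noteq> b'"
    using two_distinct_elements[OF two(2)] by blast
  have full: "H #> c [^] i \<subseteq> nfold G A (p - 1)" if "i < p" for i
  proof -
    have "p \<le> card (nfold G A (p - 1) \<inter> (H #> c [^] i))"
      using nfold_coset_growth[OF fin p exp H(1) cc A(1) ab ab', of i "p - 1"] that by auto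
    then have "nfold G A (p - 1) \<inter> (H #> c [^] i) = H #> c [^] i"
      using finc[of "c [^] i"] cardc[of "c [^] i"] cc by (intro card_seteq) auto
    then show ?thesis by blast
  qed
  show ?thesis
    using coset_powers_cover[OF fin p ord exp H cc c(2)] full nfold_closed[OF A(1)] by blast
qed

theorem nfold_eq_carrier:
  assumes fin: "finite (carrier G)" and p: "prime p" and ord: "order G = p * p"
    and exp: "\<And>x. x \<in> carrier G \<Longrightarrow> x [^] p = \<one>"
    and A: "A \<subseteq> carrier G" "card A = p + 2" "\<one> \<in> A"
  shows "nfold G A (p - 1) = carrier G"
proof (cases "\<forall>U. nonfilling A U \<longrightarrow> int p + 1 \<le> growth A U")
  case True
  have grow: "nfold G A k = carrier G \<or> 1 + k * (p + 1) \<le> card (nfold G A k)" for k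
  proof (induction k)
    case (Suc k)
    show ?case
    proof (cases "nfold G A k <#> A = carrier G")
      case False
      have "nfold G A k \<noteq> carrier G"
      proof
        assume e: "nfold G A k = carrier G"
        have "carrier G \<subseteq> carrier G <#> A"
          by (rule subset_set_mult_one) (use A(3) in auto)
        then show False using False e set_mult_closed[OF _ A(1), of "carrier G"] by auto
      qed
      then have k: "1 + k * (p + 1) \<le> card (nfold G A k)" using Suc by blast
      then have "nonfilling A (nfold G A k)"
        using False nfold_closed[OF A(1)] unfolding nonfilling_def by auto
      then have "int p + 1 \<le> growth A (nfold G A k)" using True by blast
      then show ?thesis using k unfolding growth_def by (simp add: algebra_simps)
    qed simp
  qed simp
  obtain q where "p = Suc q" using prime_gt_0_nat[OF p] gr0_implies_Suc by blast
  then have "1 + (p - 1) * (p + 1) = p * p" by simp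
  then have "nfold G A (p - 1) = carrier G \<or> card (carrier G) \<le> card (nfold G A (p - 1))"
    using grow[of "p - 1"] ord by (simp add: order_def)
  then show ?thesis using nfold_closed[OF A(1), of "p - 1"] fin by (metis card_seteq)
next
  case False
  then obtain U where U: "nonfilling A U" "growth A U \<le> int p" by force
  obtain H where H: "subgroup H G" "nonfilling A H" "growth A H \<le> int p"
    using mann[OF fin A(1) U(1)] U(2) by force
  interpret H: subgroup H G by (rule H(1))
  have le: "card (H <#> A) \<le> card H + p" using H(3) unfolding growth_def by linarith
  have "card H dvd p * p" using lagrange[OF H(1)] ord by (metis dvd_triv_right)
  then have "card H dvd p ^ 2" by (simp add: power2_eq_square)
  then obtain e where e: "e \<le> 2" "card H = p ^ e" using p by (auto simp: divides_primepow_nat)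
  have fHA: "finite (H <#> A)"
    using set_mult_closed[OF H.subset A(1)] fin by (rule finite_subset)
  have "A \<subseteq> H <#> A"
    by (rule subset_one_set_mult[OF A(1) H.one_closed])
  then have "p + 2 \<le> card (H <#> A)" using card_mono[OF fHA, of A] A(2) by simp
  then have "card H \<noteq> 1" using le by linarith
  then have "e \<noteq> 0" using e by (metis power_0)
  moreover have "e \<noteq> 2"
  proof
    assume "e = 2"
    then have "H = carrier G"
      using e ord fin H.subset by (intro card_subset_eq) (auto simp: order_def power2_eq_square)
    moreover have "H \<subseteq> H <#> A"
      by (rule subset_set_mult_one[OF H.subset A(3)])
    ultimately show False
      using H(2) set_mult_closed[OF _ A(1), of "carrier G"] unfolding nonfilling_def by auto
  qed
  ultimately have "e = 1" using e(1) by linarith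
  then have "card H = p" using e by simp
  then show ?thesis using le by (intro nfold_two_cosets[OF fin p ord exp A H(1)]) auto
qed

section \<open>Exponents and the group \<open>\<int>/p\<int> \<times> \<int>/p\<int>\<close>\<close>

lemma nfold_representation:
  assumes I: "finite I" and s: "s \<in> I \<rightarrow> carrier G"
    and g: "g \<in> nfold G (insert \<one> (s ` I)) k"
  shows "\<exists>d :: 'i \<Rightarrow> nat. sum d I \<le> k \<and> (\<Otimes>i\<in>I. s i [^] d i) = g"
  using g
proof (induction k arbitrary: g)
  case 0
  then show ?case by (intro exI[of _ "\<lambda>_. 0"]) simp
next
  case (Suc k)
  then obtain y a where y: "y \<in> nfold G (insert \<one> (s ` I)) k"
    and a: "a = \<one> \<or> a \<in> s ` I" and gy: "g = y \<otimes> a"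
    unfolding nfold.simps set_mult_def by blast
  obtain d where d: "sum d I \<le> k" "(\<Otimes>i\<in>I. s i [^] d i) = y" using Suc.IH[OF y] by blast
  have yc: "y \<in> carrier G" using d(2) s by (auto intro!: finprod_closed)
  show ?case
  proof (cases "a = \<one>")
    case True
    then show ?thesis using d gy yc by (intro exI[of _ d]) auto
  next
    case False
    then obtain j where j: "j \<in> I" "a = s j" using a by blast
    let ?d = "d(j := Suc (d j))"
    have J: "I = insert j (I - {j})" "finite (I - {j})" "j \<notin> I - {j}" using j I by auto
    have sc: "s i \<in> carrier G" if "i \<in> I" for i using s that by auto
    have split: "(\<Otimes>i\<in>I. s i [^] f i) = s j [^] f j \<otimes> (\<Otimes>i\<in>I - {j}. s i [^] f i)" for f :: "'i \<Rightarrow> nat"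
      using finprod_insert[OF J(2,3), of "\<lambda>i. s i [^] f i"] J(1) sc j by auto
    have same: "(\<Otimes>i\<in>I - {j}. s i [^] ?d i) = (\<Otimes>i\<in>I - {j}. s i [^] d i)"
      using sc by (intro finprod_cong') auto
    have rest: "(\<Otimes>i\<in>I - {j}. s i [^] d i) \<in> carrier G" using sc by (auto intro!: finprod_closed)
    have "(\<Otimes>i\<in>I. s i [^] ?d i) = s j [^] Suc (d j) \<otimes> (\<Otimes>i\<in>I - {j}. s i [^] d i)"
      unfolding split[of ?d] same by simp
    also have "\<dots> = (\<Otimes>i\<in>I. s i [^] d i) \<otimes> s j"
      unfolding split[of d] using sc[OF j(1)] rest by (simp add: m_ac)
    also have "\<dots> = g" using d(2) gy j by simp
    finally have "(\<Otimes>i\<in>I. s i [^] ?d i) = g" .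
    moreover have "sum ?d I = Suc (sum d I)"
      using j I by (simp add: sum.remove[of I j])
    ultimately show ?thesis using d(1) by (intro exI[of _ ?d]) auto
  qed
qed

end

theorem theorem4p1:
  fixes p :: nat and s :: "nat \<Rightarrow> int \<times> int" and g :: "int \<times> int"
  assumes "prime p"
    and "\<And>i. i \<in> {1..p + 1} \<Longrightarrow> s i \<in> carrier (ZZ_mod p)"
    and "\<And>i. i \<in> {1..p + 1} \<Longrightarrow> s i \<noteq> \<one>\<^bsub>ZZ_mod p\<^esub>"
    and "inj_on s {1..p + 1}"
    and "g \<in> carrier (ZZ_mod p)" and "g \<noteq> \<one>\<^bsub>ZZ_mod p\<^esub>"
  shows "\<exists>d :: nat \<Rightarrow> nat. (\<Sum>i = 1..p + 1. d i) \<le> p - 1 \<and>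
           (\<Otimes>\<^bsub>ZZ_mod p\<^esub>i\<in>{1..p + 1}. s i [^]\<^bsub>ZZ_mod p\<^esub> d i) = g"
proof -
  let ?G = "ZZ_mod p"
  interpret comm_group ?G by (rule comm_group_ZZ_mod)
  have p0: "p > 0" using assms(1) by (simp add: prime_gt_0_nat)
  have car: "carrier ?G = {0..<int p} \<times> {0..<int p}"
    using p0 by (simp add: ZZ_mod_def DirProd_def carrier_integer_mod_group)
  have fin: "finite (carrier ?G)" unfolding car by simp
  have ord: "order ?G = p * p" unfolding order_def car by (simp add: card_cartesian_product)
  have pow: "(x, y) [^]\<^bsub>?G\<^esub> k = (int k * x mod int p, int k * y mod int p)"
    if "(x, y) \<in> carrier ?G" for x y and k :: nat
    using that by (induction k) (auto simp: ZZ_mod_def DirProd_def algebra_simps mod_simps)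
  have exp: "x [^]\<^bsub>?G\<^esub> p = \<one>\<^bsub>?G\<^esub>" if "x \<in> carrier ?G" for x
    using that pow[of "fst x" "snd x" p] by (simp add: ZZ_mod_def)
  define A where "A = insert \<one>\<^bsub>?G\<^esub> (s ` {1..p + 1})"
  have "\<one>\<^bsub>?G\<^esub> \<notin> s ` {1..p + 1}" using assms(3) by force
  then have "card A = Suc (card (s ` {1..p + 1}))" by (simp add: A_def)
  then have "card A = p + 2" using assms(4) by (simp add: card_image)
  moreover have "A \<subseteq> carrier ?G" using assms(2) by (auto simp: A_def)
  ultimately have "nfold ?G A (p - 1) = carrier ?G"
    using nfold_eq_carrier[OF fin assms(1) ord exp, of A] by (simp add: A_def)
  then have "g \<in> nfold ?G (insert \<one>\<^bsub>?G\<^esub> (s ` {1..p + 1})) (p - 1)"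
    using assms(5) by (simp add: A_def)
  then show ?thesis using assms(2) by (intro nfold_representation) auto
qed

end
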